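(* Let $\tau:\mathcal{W}^*\to\mathcal{S}^*$ be the word-to-subword map of a beginning-of-word-marking tokeniser. For a word sequence $\mathbf{w}\in\mathcal{W}^*$ write $\mathbf{s}^{\mathbf{w}}:=\tau(\mathbf{w})$, and for a word $w\in\mathcal{W}$ write $\mathbf{s}^{w}:=\tau_1(w)$ (the image under $\tau$ of the one-word sequence $w$), with entries $s^{w}_{t'}$ and prefixes $\mathbf{s}^{w}_{<t'}$. Let an overline denote the union of a set with $\{\mathrm{eos}\}$, so that $\overline{\mathcal{S}}_{\mathrm{bow}}=\mathcal{S}_{\mathrm{bow}}\cup\{\mathrm{eos}\}$ and $\overline{\mathcal{S}_{\mathrm{bow}}\circ\mathcal{S}^*}=(\mathcal{S}_{\mathrm{bow}}\circ\mathcal{S}^* )\cup\{\mathrm{eos}\}$. Then for a word sequence $\mathbf{w}_{<t}\in\mathcal{W}^*$ and a word $w\in\mathcal{W}$: $$\mathbb{P}_{\mathcal{W}}(\mathbf{w}_{<t}\circ\mathcal{W}^* )=\mathbb{P}_{\mathcal{S}}\left(\mathbf{s}^{\mathbf{w}_{<t}}\circ\overline{\mathcal{S}_{\mathrm{bow}}\circ\mathcal{S}^*}\right),$$ $$\mathbb{P}_{\mathcal{W}}(\mathbf{w}_{<t}\circ w\circ\mathcal{W}^* )=\mathbb{P}_{\mathcal{S}}\left(\mathbf{s}^{\mathbf{w}_{<t}}\circ\mathbf{s}^{w}\circ\overline{\mathcal{S}_{\mathrm{bow}}\circ\mathcal{S}^*}\right).$$ Further, a word's contextual probability can be computed as $$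p(w\mid\mathbf{w}_{<t})=\left(\prod_{t'=1}^{|\mathbf{s}^{w}|}p\left(s^{w}_{t'}\mid\mathbf{s}^{\mathbf{w}_{<t}}\circ\mathbf{s}^{w}_{<t'}\right)\right)\cdot\frac{\sum_{s\in\overline{\mathcal{S}}_{\mathrm{bow}}}p\left(s\mid\mathbf{s}^{\mathbf{w}_{<t}}\circ\mathbf{s}^{w}\right)}{\sum_{s\in\overline{\mathcal{S}}_{\mathrm{bow}}}p\left(s\mid\mathbf{s}^{\mathbf{w}_{<t}}\right)}.$$
   Context: Sequences. $\mathcal{W}$ (the lexicon) is a possibly infinite set whose elements are words; $\mathcal{C}$ (the alphabet) is a set of characters; $\mathcal{S}$ (the vocabulary) is a set whose elements are subwords. $X^*$ denotes the set of all finite sequences over $X$ (including the empty one), $|\cdot|$ denotes length, and $\circ$ denotes concatenation of sequences, extended elementwise to sets, e.g. $\mathbf{w}\circ\mathcal{W}^*=\{\mathbf{w}\circ\mathbf{w}'\mid\mathbf{w}'\in\mathcal{W}^*\}$. For a sequence $\mathbf{x}=x_1x_2\cdots$, $\mathbf{x}_{<t}=x_1\cdots x_{t-1}$. The symbol $\mathrm{eos}\notin\mathcal{S}$ is a special end-of-sequence symbol; concatenating a sequence with $\mathrm{eos}$ is defined to give the sequence itself, $\mathbf{s}\circ\mathrm{eos}=\mathbf{s}$ (so $\mathbf{s}\circ\overline{\mathcal{S}_{\mathrm{bow}}\circ\mathcal{S}^*}=(\mathbf{s}\circ\mathcal{S}_{\mathrm{bow}}\circ\mathcal{S}^* )\cup\{\mathbf{s}\}$).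 Tokeniser. There are maps $\mathcal{W}^*\to\mathcal{C}^*$ (orthography) and $\mathcal{C}^*\to\mathcal{W}^*$ (segmentation of characters into words). A tokeniser consists of a vocabulary $\mathcal{S}$, a detokenisation function $\mathcal{S}^*\to\mathcal{C}^*$ and a (deterministic) tokenisation function $\mathcal{C}^*\to\mathcal{S}^*$. The word-to-subword map $\tau:\mathcal{W}^*\to\mathcal{S}^*$ is the composition $\mathcal{W}^*\to\mathcal{C}^*\to\mathcal{S}^*$, and the subword-to-word map $\delta:\mathcal{S}^*\to\mathcal{W}^*$ is the composition $\mathcal{S}^*\to\mathcal{C}^*\to\mathcal{W}^*$. It is assumed throughout that $\delta(\tau(\mathbf{w}))=\mathbf{w}$ for all $\mathbf{w}\in\mathcal{W}^*$ (so $\tau$ is injective); $\tau(\delta(\mathbf{s}))=\mathbf{s}$ need not hold, and $\tau$ need not be surjective. Segmentation-compatible tokeniser: there is a word-level map $\tau_1:\mathcal{W}\to\mathcal{S}^*$ with $\tau(\mathbf{w})=\tau_1(w_1)\circ\tau_1(w_2)\circ\cdots\circ\tau_1(w_{|\mathbf{w}|})$ for all $\mathbf{w}\in\mathcal{W}^*$. Beginning-of-word-marking tokeniser: a segmentation-compatible tokeniser together with a subset $\mathcal{S}_{\mathrm{bow}}\subseteq\mathcal{S}$, with $\mathcal{S}_{\mathrm{mid}}:=\mathcal{S}\setminus\mathcal{S}_{\mathrm{bow}}$, such that $\tau_1(w)\in\mathcal{S}_{\mathrm{bow}}\circ\mathcal{S}_{\mathrm{mid}}^*$ for every $w\in\mathcal{W}$.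 Probabilities. $p$ is a probability distribution (mass function) on $\mathcal{W}^*$. It induces a distribution on $\mathcal{S}^*$, also denoted $p$, by $p(\mathbf{s})=\sum_{\mathbf{w}\in\mathcal{W}^*}p(\mathbf{w})\,\mathbf{1}\{\mathbf{s}=\tau(\mathbf{w})\}$. For $\Psi\subseteq\mathcal{W}^*$ put $\mathbb{P}_{\mathcal{W}}(\Psi)=\sum_{\mathbf{w}\in\Psi}p(\mathbf{w})$, and for $\Psi\subseteq\mathcal{S}^*$ put $\mathbb{P}_{\mathcal{S}}(\Psi)=\sum_{\mathbf{s}\in\Psi}p(\mathbf{s})$. Conditional probabilities are the quotients (defined when the denominator is nonzero) $$p(w\mid\mathbf{w}_{<t})=\frac{\mathbb{P}_{\mathcal{W}}(\mathbf{w}_{<t}\circ w\circ\mathcal{W}^* )}{\mathbb{P}_{\mathcal{W}}(\mathbf{w}_{<t}\circ\mathcal{W}^* )},\qquad p(s\mid\mathbf{s}')=\frac{\mathbb{P}_{\mathcal{S}}(\mathbf{s}'\circ s\circ\mathcal{S}^* )}{\mathbb{P}_{\mathcal{S}}(\mathbf{s}'\circ\mathcal{S}^* )},\qquad p(\mathrm{eos}\mid\mathbf{s}')=\frac{p(\mathbf{s}')}{\mathbb{P}_{\mathcal{S}}(\mathbf{s}'\circ\mathcal{S}^* )}$$ for $w\in\mathcal{W}$, $\mathbf{w}_{<t}\in\mathcal{W}^*$, $s\in\mathcal{S}$, $\mathbf{s}'\in\mathcal{S}^*$. *)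

theory Defs
  imports "HOL-Probability.Probability"
begin

text \<open>
  The finite sequences over a set \<open>X\<close> are \<open>lists X\<close>; for a sequence \<open>x\<close> and a set \<open>A\<close>
  of sequences, \<open>(@) x ` A\<close> is the set of all \<open>x @ y\<close> with \<open>y \<in> A\<close>; for a set \<open>B\<close> of
  symbols, \<open>set_Cons B A\<close> is the set of all \<open>b # y\<close> with \<open>b \<in> B\<close> and \<open>y \<in> A\<close>.
\<close>

subsection \<open>Tokenisers\<close>

locale tokeniser =
  fixes W :: "'w set" and C :: "'c set" and S :: "'s set"
    and orth :: "'w list \<Rightarrow> 'c list" and segm :: "'c list \<Rightarrow> 'w list"
    and detok :: "'s list \<Rightarrow> 'c list" and tok :: "'c list \<Rightarrow> 's list"
  assumes orth: "orth \<in> lists W \<rightarrow> lists C"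
    and segm: "segm \<in> lists C \<rightarrow> lists W"
    and detok: "detok \<in> lists S \<rightarrow> lists C"
    and tok: "tok \<in> lists C \<rightarrow> lists S"
    and lossless: "\<And>ws. ws \<in> lists W \<Longrightarrow> (segm \<circ> detok) ((tok \<circ> orth) ws) = ws"

locale segmentation_compatible_tokeniser = tokeniser W C S orth segm detok tok
  for W :: "'w set" and C :: "'c set" and S :: "'s set"
    and orth :: "'w list \<Rightarrow> 'c list" and segm :: "'c list \<Rightarrow> 'w list"
    and detok :: "'s list \<Rightarrow> 'c list" and tok :: "'c list \<Rightarrow> 's list" +
  fixes \<tau>\<^sub>1 :: "'w \<Rightarrow> 's list"
  assumes word_level: "\<And>w. w \<in> W \<Longrightarrow> \<tau>\<^sub>1 w \<in> lists S"
    and compatible: "\<And>ws. ws \<in> lists W \<Longrightarrow> (tok \<circ> orth) ws = concat (map \<tau>\<^sub>1 ws)"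

locale bow_marking_tokeniser =
  segmentation_compatible_tokeniser W C S orth segm detok tok \<tau>\<^sub>1
  for W :: "'w set" and C :: "'c set" and S :: "'s set"
    and orth :: "'w list \<Rightarrow> 'c list" and segm :: "'c list \<Rightarrow> 'w list"
    and detok :: "'s list \<Rightarrow> 'c list" and tok :: "'c list \<Rightarrow> 's list"
    and \<tau>\<^sub>1 :: "'w \<Rightarrow> 's list" +
  fixes Sbow :: "'s set"
  assumes bow_subset: "Sbow \<subseteq> S"
    and bow_marking: "\<And>w. w \<in> W \<Longrightarrow> \<tau>\<^sub>1 w \<in> set_Cons Sbow (lists (S - Sbow))"

subsection \<open>The end-of-sequence symbol\<close>

text \<open>
  \<open>with_eos A\<close> is the overlined set; \<open>'a\<close> is a type of subwords in one use and a type of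
  subword sequences in the other.
\<close>

datatype 'a eos_ext = Reg 'a | Eos

definition with_eos :: "'a set \<Rightarrow> 'a eos_ext set" where
  "with_eos A = insert Eos (Reg ` A)"

fun append_eos :: "'a list \<Rightarrow> 'a list eos_ext \<Rightarrow> 'a list" where
  "append_eos x (Reg y) = x @ y"
| "append_eos x Eos = x"

subsection \<open>Probabilities\<close>

definition mass :: "('a list \<Rightarrow> real) \<Rightarrow> 'a list set \<Rightarrow> real" where
  "mass q A = (\<Sum>\<^sub>\<infinity>x\<in>A. q x)"

definition induced_mass :: "'w set \<Rightarrow> ('w list \<Rightarrow> 's list) \<Rightarrow> ('w list \<Rightarrow> real) \<Rightarrow> 's list \<Rightarrow> real" where
  "induced_mass W \<tau> p s = (\<Sum>\<^sub>\<infinity>ws\<in>lists W. p ws * of_bool (s = \<tau> ws))"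

text \<open>
  \<open>cond_mass X q y x\<close> is the conditional probability of the symbol \<open>y\<close> given the prefix \<open>x\<close>,
  for the mass function \<open>q\<close> on \<open>lists X\<close>. It is only meaningful when the denominator is nonzero.
\<close>

fun cond_mass :: "'a set \<Rightarrow> ('a list \<Rightarrow> real) \<Rightarrow> 'a eos_ext \<Rightarrow> 'a list \<Rightarrow> real" where
  "cond_mass X q (Reg a) x = mass q ((@) (x @ [a]) ` lists X) / mass q ((@) x ` lists X)"
| "cond_mass X q Eos x = q x / mass q ((@) x ` lists X)"

end

theory Submission
  imports Defs
begin

text \<open>
  Since a token in \<open>Sbow\<close> starts a word and no token of \<open>S - Sbow\<close> does, a token sequence
  that extends \<open>\<tau> ws\<close> by nothing or by something beginning in \<open>Sbow\<close> can only be the image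
  of a word sequence extending \<open>ws\<close>: the word boundaries in it are visible. The event of
  having the prefix \<open>ws\<close> is therefore the preimage of the overlined event under \<open>\<tau>\<close>. Splitting
  that event by its next symbol, its mass is the mass of the cylinder over \<open>\<tau> ws\<close> times the sum of
  the conditional probabilities of \<open>Eos\<close> and of the symbols in \<open>Sbow\<close>. In the quotient of two such
  products the ratio of the cylinder masses telescopes into next-token probabilities.
\<close>

section \<open>Mass functions as probability measures, and sums over disjoint events\<close>

lemma pmf_summable_on: "pmf p summable_on A"
  using summable_on_iff_abs_summable_on_real abs_summable_equivalent pmf_abs_summable by blast

lemma mass_pmf: "mass (pmf p) A = measure_pmf.prob p A"
  unfolding mass_def
  by (simp add: measure_pmf_conv_infsetsum infsetsum_infsum pmf_abs_summable)

text \<open>Since \<open>p\<close> vanishes outside \<open>lists W\<close>, the sum may run over the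
  whole fibre of \<open>\<tau>\<close>, which gives the pushforward of \<open>p\<close>. Masses of
  token sequences thereby become probabilities as well.\<close>

lemma induced_mass_pmf:
  assumes "set_pmf p \<subseteq> lists W"
  shows "induced_mass W \<tau> (pmf p) = pmf (map_pmf \<tau> p)"
proof
  fix s
  have "induced_mass W \<tau> (pmf p) s = mass (pmf p) (\<tau> -` {s})"
    unfolding induced_mass_def mass_def
    by (rule infsum_cong_neutral) (use assms in \<open>auto simp: pmf_eq_0_set_pmf\<close>)
  then show "induced_mass W \<tau> (pmf p) s = pmf (map_pmf \<tau> p) s"
    by (simp add: mass_pmf pmf_map)
qed

text \<open>Disjointness makes \<open>snd\<close> injective on \<open>Sigma I F\<close>, so the sum
  over the union becomes a double sum. The index set may be infinite, as the vocabulary may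
  be.\<close>

lemma mass_UN_disjoint:
  assumes "q summable_on (\<Union>i\<in>I. F i)" "disjoint_family_on F I"
  shows "mass q (\<Union>i\<in>I. F i) = (\<Sum>\<^sub>\<infinity>i\<in>I. mass q (F i))"
proof -
  have img: "(\<Union>i\<in>I. F i) = snd ` Sigma I F"
    by force
  have inj: "inj_on snd (Sigma I F)"
    using assms(2) by (force simp: disjoint_family_on_def inj_on_def)
  have "(q \<circ> snd) summable_on Sigma I F"
    using assms(1) summable_on_reindex[OF inj, of q] unfolding img by (rule iffD1[rotated])
  then have "(\<Sum>\<^sub>\<infinity>i\<in>I. \<Sum>\<^sub>\<infinity>x\<in>F i. (q \<circ> snd) (i, x)) = infsum (q \<circ> snd) (Sigma I F)"
    by (rule infsum_Sigma_banach)
  then show ?thesis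
    by (simp add: mass_def img infsum_reindex[OF inj])
qed

section \<open>Next symbols and the chain rule\<close>

fun next_event :: "'a set \<Rightarrow> 'a list \<Rightarrow> 'a eos_ext \<Rightarrow> 'a list set" where
  "next_event X x (Reg a) = (@) (x @ [a]) ` lists X"
| "next_event X x Eos = {x}"

text \<open>Both kinds of numerator, the mass of a cylinder and that of a single sequence, take one
  form, so \<open>Eos\<close> can be summed like any other symbol.\<close>

lemma cond_mass_eq_next_event:
  "cond_mass X q s x = mass q (next_event X x s) / mass q ((@) x ` lists X)"
  by (cases s) (simp_all add: mass_def)

lemma disjoint_next_event: "disjoint_family_on (next_event X x) A"
  unfolding disjoint_family_on_def
proof (intro ballI impI)
  fix s t :: "'a eos_ext"
  assume "s \<noteq> t"
  then show "next_event X x s \<inter> next_event X x t = {}"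
    by (cases s; cases t) auto
qed

lemma append_eos_image:
  "append_eos x ` with_eos (set_Cons B (lists X)) = (\<Union>s\<in>with_eos B. next_event X x s)"
  by (force simp: with_eos_def set_Cons_def image_iff)

text \<open>The numerators are masses of disjoint events whose union is the overlined set. If the
  cylinder over \<open>x\<close> has mass zero, both sides are zero because division by zero yields
  zero.\<close>

lemma sum_cond_mass:
  "(\<Sum>\<^sub>\<infinity>s\<in>with_eos B. cond_mass X (pmf Q) s x) =
     mass (pmf Q) (append_eos x ` with_eos (set_Cons B (lists X))) / mass (pmf Q) ((@) x ` lists X)"
proof -
  have "(\<Sum>\<^sub>\<infinity>s\<in>with_eos B. cond_mass X (pmf Q) s x) =
      (\<Sum>\<^sub>\<infinity>s\<in>with_eos B. mass (pmf Q) (next_event X x s)) / mass (pmf Q) ((@) x ` lists X)"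
    by (simp add: cond_mass_eq_next_event divide_inverse infsum_cmult_left')
  then show ?thesis
    by (simp add: append_eos_image mass_UN_disjoint[OF pmf_summable_on disjoint_next_event])
qed

lemma append_eos_image_subset:
  assumes "B \<subseteq> X"
  shows "append_eos x ` with_eos (set_Cons B (lists X)) \<subseteq> (@) x ` lists X"
  using assms by (force simp: with_eos_def set_Cons_def)

text \<open>Cancellation fails where \<open>D i = 0\<close>, but then the second hypothesis makes
  every later value zero, so both sides vanish.\<close>

lemma prod_telescope_ratio:
  fixes D :: "nat \<Rightarrow> real"
  assumes "D 0 \<noteq> 0" and "\<And>i. i < n \<Longrightarrow> D i = 0 \<Longrightarrow> D (Suc i) = 0"
  shows "(\<Prod>i<n. D (Suc i) / D i) = D n / D 0"
  using assms by (induction n) auto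

lemma prod_cond_mass:
  assumes "mass (pmf Q) ((@) x ` lists X) \<noteq> 0" "y \<in> lists X"
  shows "(\<Prod>i<length y. cond_mass X (pmf Q) (Reg (y ! i)) (x @ take i y)) =
    mass (pmf Q) ((@) (x @ y) ` lists X) / mass (pmf Q) ((@) x ` lists X)"
proof -
  define D where "D i = mass (pmf Q) ((@) (x @ take i y) ` lists X)" for i
  \<comment> \<open>The cylinders shrink as \<open>i\<close> grows, so a mass that has reached zero
    stays zero, as telescoping requires.\<close>
  have zero: "D (Suc i) = 0" if "i < length y" "D i = 0" for i
  proof -
    have "y ! i \<in> X"
      using assms(2) that(1) by auto
    then have "(@) (x @ take (Suc i) y) ` lists X \<subseteq> (@) (x @ take i y) ` lists X"
      using that(1) by (auto simp: take_Suc_conv_app_nth image_iff)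
    then have "D (Suc i) \<le> D i"
      unfolding D_def mass_pmf by (intro measure_pmf.finite_measure_mono) auto
    moreover have "D (Suc i) \<ge> 0"
      by (simp add: D_def mass_pmf)
    ultimately show ?thesis
      using that(2) by simp
  qed
  have "(\<Prod>i<length y. cond_mass X (pmf Q) (Reg (y ! i)) (x @ take i y)) =
      (\<Prod>i<length y. D (Suc i) / D i)"
    by (rule prod.cong) (auto simp: D_def take_Suc_conv_app_nth)
  also have "\<dots> = D (length y) / D 0"
    using assms(1) zero by (intro prod_telescope_ratio) (auto simp: D_def)
  finally show ?thesis
    by (simp add: D_def)
qed

section \<open>Recovering word boundaries from tokens\<close>

lemma set_Cons_mid_append_unique:
  assumes "b # m @ r = b' # m' @ r'" "set m \<inter> B = {}" "set m' \<inter> B = {}"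
    and "r = [] \<or> hd r \<in> B" "r' = [] \<or> hd r' \<in> B"
  shows "b # m = b' # m'" "r = r'"
proof -
  \<comment> \<open>The rest \<open>t\<close> is empty or starts in \<open>B\<close>, so
    \<open>takeWhile\<close> stops exactly at the end of \<open>l\<close>; this reads the block off
    the whole sequence.\<close>
  have takeW: "takeWhile (\<lambda>x. x \<notin> B) (l @ t) = l"
    if "set l \<inter> B = {}" "t = [] \<or> hd t \<in> B" for l t
    using that by (cases t) (auto simp: takeWhile_append takeWhile_eq_all_conv)
  have "m = m'"
    using assms takeW[of m r] takeW[of m' r'] by simp
  then show "b # m = b' # m'" "r = r'"
    using assms(1) by auto
qed

context bow_marking_tokeniser
begin

lemma \<tau>\<^sub>1_inj:
  assumes "v \<in> W" "w \<in> W" "\<tau>\<^sub>1 v = \<tau>\<^sub>1 w"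
  shows "v = w"
  using assms compatible[of "[v]"] compatible[of "[w]"] lossless[of "[v]"] lossless[of "[w]"]
  by simp

lemma concat_bow:
  assumes "vs \<in> lists W"
  shows "concat (map \<tau>\<^sub>1 vs) = [] \<or> hd (concat (map \<tau>\<^sub>1 vs)) \<in> Sbow"
  using assms bow_marking by (cases vs) (fastforce simp: set_Cons_def)+

lemma concat_in_lists:
  assumes "vs \<in> lists W"
  shows "concat (map \<tau>\<^sub>1 vs) \<in> lists S"
  using assms word_level by (fastforce simp: in_lists_conv_set)

text \<open>The words of \<open>us\<close> are cancelled one at a time: marked boundaries force the
  first token blocks to agree, and injectivity of \<open>\<tau>\<^sub>1\<close> then identifies the
  words.\<close>

lemma concat_prefix_cancel:
  assumes "us \<in> lists W" "vs \<in> lists W" "r = [] \<or> hd r \<in> Sbow"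
    and "concat (map \<tau>\<^sub>1 vs) = concat (map \<tau>\<^sub>1 us) @ r"
  shows "vs \<in> (@) us ` lists W"
  using assms
proof (induction us arbitrary: vs rule: list.induct)
  case Nil
  then show ?case by simp
next
  case (Cons u us)
  have u: "u \<in> W" and us: "us \<in> lists W"
    using Cons.prems(1) by auto
  obtain b m where bm: "\<tau>\<^sub>1 u = b # m" "set m \<inter> Sbow = {}"
    using bow_marking[OF u] by (auto simp: set_Cons_def)
  \<comment> \<open>\<open>vs\<close> cannot be empty, since the block of \<open>u\<close>
    contributes at least the token \<open>b\<close>.\<close>
  obtain v vs' where vs: "vs = v # vs'"
    using Cons.prems(4) bm(1) by (cases vs) auto
  then have v: "v \<in> W" and vs': "vs' \<in> lists W"
    using Cons.prems(2) by auto
  obtain b' m' where bm': "\<tau>\<^sub>1 v = b' # m'" "set m' \<inter> Sbow = {}"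
    using bow_marking[OF v] by (auto simp: set_Cons_def)
  have eq: "b' # m' @ concat (map \<tau>\<^sub>1 vs') = b # m @ (concat (map \<tau>\<^sub>1 us) @ r)"
    using Cons.prems(4) vs bm(1) bm'(1) by simp
  \<comment> \<open>The boundary after the block of \<open>u\<close> is marked by the next word of
    \<open>us\<close>, or by the condition on \<open>r\<close> when no word is left.\<close>
  have hd: "concat (map \<tau>\<^sub>1 us) @ r = [] \<or> hd (concat (map \<tau>\<^sub>1 us) @ r) \<in> Sbow"
    using concat_bow[OF us] Cons.prems(3) by (metis append_Nil hd_append2)
  note cancel = set_Cons_mid_append_unique[OF eq bm'(2) bm(2) concat_bow[OF vs'] hd]
  have "v = u"
    using \<tau>\<^sub>1_inj[OF v u] cancel(1) bm(1) bm'(1) by simp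
  moreover have "vs' \<in> (@) us ` lists W"
    using Cons.IH[OF us vs' Cons.prems(3) cancel(2)] .
  ultimately show ?case
    by (auto simp: vs)
qed

lemma prefix_iff_token_prefix:
  assumes "us \<in> lists W" "vs \<in> lists W"
  shows "vs \<in> (@) us ` lists W \<longleftrightarrow>
    concat (map \<tau>\<^sub>1 vs) \<in> append_eos (concat (map \<tau>\<^sub>1 us)) ` with_eos (set_Cons Sbow (lists S))"
    (is "_ \<longleftrightarrow> _ \<in> ?R")
proof
  assume "vs \<in> (@) us ` lists W"
  then obtain vs' where vs': "vs = us @ vs'" "vs' \<in> lists W"
    by auto
  \<comment> \<open>No remaining words gives the \<open>Eos\<close> case; otherwise the first
    remaining word supplies a leading token in \<open>Sbow\<close>.\<close>
  have "concat (map \<tau>\<^sub>1 vs') = [] \<or> concat (map \<tau>\<^sub>1 vs') \<in> set_Cons Sbow (lists S)"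
    using concat_bow[OF vs'(2)] concat_in_lists[OF vs'(2)]
    by (cases "concat (map \<tau>\<^sub>1 vs')") (auto simp: set_Cons_def)
  then show "concat (map \<tau>\<^sub>1 vs) \<in> ?R"
  proof
    assume "concat (map \<tau>\<^sub>1 vs') = []"
    then have "concat (map \<tau>\<^sub>1 vs) = append_eos (concat (map \<tau>\<^sub>1 us)) Eos"
      by (simp add: vs'(1))
    then show ?thesis
      unfolding with_eos_def by blast
  next
    assume mem: "concat (map \<tau>\<^sub>1 vs') \<in> set_Cons Sbow (lists S)"
    have "concat (map \<tau>\<^sub>1 vs) =
        append_eos (concat (map \<tau>\<^sub>1 us)) (Reg (concat (map \<tau>\<^sub>1 vs')))"
      by (simp add: vs'(1))
    then show ?thesis
      using mem unfolding with_eos_def by blast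
  qed
next
  assume "concat (map \<tau>\<^sub>1 vs) \<in> ?R"
  then obtain r where "r = [] \<or> hd r \<in> Sbow"
    and "concat (map \<tau>\<^sub>1 vs) = concat (map \<tau>\<^sub>1 us) @ r"
    by (fastforce simp: with_eos_def set_Cons_def)
  then show "vs \<in> (@) us ` lists W"
    using concat_prefix_cancel[OF assms] by blast
qed

lemma mass_prefix:
  assumes "set_pmf p \<subseteq> lists W" "us \<in> lists W"
  shows "mass (pmf p) ((@) us ` lists W) =
    mass (pmf (map_pmf (tok \<circ> orth) p))
      (append_eos ((tok \<circ> orth) us) ` with_eos (set_Cons Sbow (lists S)))"
    (is "_ = mass _ ?R")
proof -
  \<comment> \<open>Agreement on the support suffices: the preimage of \<open>?R\<close> may contain
    lists outside \<open>lists W\<close>, but these have probability zero.\<close>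
  have "vs \<in> (@) us ` lists W \<longleftrightarrow> (tok \<circ> orth) vs \<in> ?R" if "vs \<in> set_pmf p" for vs
    using prefix_iff_token_prefix[OF assms(2)] assms that
    by (metis compatible subsetD)
  then have "measure_pmf.prob p ((@) us ` lists W) = measure_pmf.prob p ((tok \<circ> orth) -` ?R)"
    by (intro measure_pmf.finite_measure_eq_AE) (auto simp: AE_measure_pmf_iff)
  then show ?thesis
    by (simp add: mass_pmf)
qed

end

theorem theorem2:
  fixes W :: "'w set" and C :: "'c set" and S Sbow :: "'s set"
    and orth :: "'w list \<Rightarrow> 'c list" and segm :: "'c list \<Rightarrow> 'w list"
    and detok :: "'s list \<Rightarrow> 'c list" and tok :: "'c list \<Rightarrow> 's list"
    and \<tau> :: "'w list \<Rightarrow> 's list" and \<tau>\<^sub>1 :: "'w \<Rightarrow> 's list"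
    and p :: "'w list pmf" and q :: "'s list \<Rightarrow> real"
    and ws :: "'w list" and w :: 'w
  assumes "bow_marking_tokeniser W C S orth segm detok tok \<tau>\<^sub>1 Sbow"
    and "\<tau> = tok \<circ> orth"
    and "set_pmf p \<subseteq> lists W"
    and "q = induced_mass W \<tau> (pmf p)"
    and "ws \<in> lists W" and "w \<in> W"
  shows "mass (pmf p) ((@) ws ` lists W) =
           mass q (append_eos (\<tau> ws) ` with_eos (set_Cons Sbow (lists S))) \<and>
         mass (pmf p) ((@) (ws @ [w]) ` lists W) =
           mass q (append_eos (\<tau> ws @ \<tau>\<^sub>1 w) ` with_eos (set_Cons Sbow (lists S))) \<and>
         (mass (pmf p) ((@) ws ` lists W) \<noteq> 0 \<longrightarrow>
           cond_mass W (pmf p) (Reg w) ws =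
             (\<Prod>i<length (\<tau>\<^sub>1 w). cond_mass S q (Reg (\<tau>\<^sub>1 w ! i)) (\<tau> ws @ take i (\<tau>\<^sub>1 w))) *
             ((\<Sum>\<^sub>\<infinity>s\<in>with_eos Sbow. cond_mass S q s (\<tau> ws @ \<tau>\<^sub>1 w)) /
              (\<Sum>\<^sub>\<infinity>s\<in>with_eos Sbow. cond_mass S q s (\<tau> ws))))"
proof -
  interpret bow_marking_tokeniser W C S orth segm detok tok \<tau>\<^sub>1 Sbow
    by fact
  define Q where "Q = map_pmf \<tau> p"
  have q: "q = pmf Q"
    using assms(3,4) by (simp add: Q_def induced_mass_pmf)
  have wsw: "ws @ [w] \<in> lists W"
    using assms(5,6) by simp
  have \<tau>: "\<tau> (ws @ [w]) = \<tau> ws @ \<tau>\<^sub>1 w"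
    using compatible[OF wsw] compatible[OF assms(5)] by (simp add: assms(2))
  let ?E = "\<lambda>x. append_eos x ` with_eos (set_Cons Sbow (lists S))"
  let ?D = "\<lambda>x. mass q ((@) x ` lists S)"
  have M0: "mass (pmf p) ((@) ws ` lists W) = mass q (?E (\<tau> ws))"
    using mass_prefix[OF assms(3,5)] by (simp only: q Q_def assms(2))
  have M1: "mass (pmf p) ((@) (ws @ [w]) ` lists W) = mass q (?E (\<tau> ws @ \<tau>\<^sub>1 w))"
    using mass_prefix[OF assms(3) wsw] \<tau> by (simp only: q Q_def assms(2))
  \<comment> \<open>The overlined event lies inside the cylinder, so it has mass zero whenever the
    cylinder does.\<close>
  have le: "0 \<le> mass q (?E x)" "mass q (?E x) \<le> ?D x" for x
    unfolding q mass_pmf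
    by (auto intro!: measure_pmf.finite_measure_mono append_eos_image_subset[OF bow_subset])
  have "cond_mass W (pmf p) (Reg w) ws =
      (\<Prod>i<length (\<tau>\<^sub>1 w). cond_mass S q (Reg (\<tau>\<^sub>1 w ! i)) (\<tau> ws @ take i (\<tau>\<^sub>1 w))) *
      ((\<Sum>\<^sub>\<infinity>s\<in>with_eos Sbow. cond_mass S q s (\<tau> ws @ \<tau>\<^sub>1 w)) /
       (\<Sum>\<^sub>\<infinity>s\<in>with_eos Sbow. cond_mass S q s (\<tau> ws)))"
    if "mass (pmf p) ((@) ws ` lists W) \<noteq> 0"
  proof -
    have D0: "?D (\<tau> ws) \<noteq> 0"
      using that le[of "\<tau> ws"] by (auto simp: M0)
    \<comment> \<open>This cylinder may be null although the conditioning event is not. Then the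
      left side has numerator zero and the product on the right is zero.\<close>
    have zero: "mass q (?E (\<tau> ws @ \<tau>\<^sub>1 w)) = 0" if "?D (\<tau> ws @ \<tau>\<^sub>1 w) = 0"
      using that le[of "\<tau> ws @ \<tau>\<^sub>1 w"] by linarith
    have prod: "(\<Prod>i<length (\<tau>\<^sub>1 w). cond_mass S q (Reg (\<tau>\<^sub>1 w ! i)) (\<tau> ws @ take i (\<tau>\<^sub>1 w))) =
        ?D (\<tau> ws @ \<tau>\<^sub>1 w) / ?D (\<tau> ws)"
      using prod_cond_mass D0 word_level[OF assms(6)] unfolding q by blast
    have sum: "(\<Sum>\<^sub>\<infinity>s\<in>with_eos Sbow. cond_mass S q s x) = mass q (?E x) / ?D x" for x
      unfolding q by (rule sum_cond_mass)
    have cond: "cond_mass W (pmf p) (Reg w) ws =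
        mass q (?E (\<tau> ws @ \<tau>\<^sub>1 w)) / mass q (?E (\<tau> ws))"
      by (simp only: cond_mass.simps M0 M1)
    show ?thesis
      unfolding cond prod sum
      using D0 zero by (cases "?D (\<tau> ws @ \<tau>\<^sub>1 w) = 0") simp_all
  qed
  with M0 M1 show ?thesis
    by blast
qed

end
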